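(* Let $v,k,\lambda$ be nonnegative integers and let $a$ be a positive divisor of $\lambda+2$; put $t=(\lambda+2)/a$. Let $\Gamma^{(1)},\dots,\Gamma^{(t)}$ be (pairwise vertex-disjoint) edge-regular graphs with parameters $(v,k,\lambda)$, and suppose that for each $\ell\in\{1,\dots,t\}$ the vertex set of $\Gamma^{(\ell)}$ is partitioned into perfect $1$-codes $H^{(\ell)}_1,\dots,H^{(\ell)}_{v/a}$ of $\Gamma^{(\ell)}$, each of size $a$. If $t\ge 2$, let $\Pi=(\pi_2,\dots,\pi_t)$ be any $(t-1)$-tuple of permutations of $\{1,\dots,v/a\}$ (if $t=1$, $\Pi$ is empty). Let $F_\Pi(\Gamma^{(1)},\dots,\Gamma^{(t)})$ be the graph obtained from the disjoint union of $\Gamma^{(1)},\dots,\Gamma^{(t)}$ by, for every $i\in\{1,\dots,v/a\}$, adding an edge between every two distinct vertices of $H^{(1)}_i\cup H^{(2)}_{\pi_2(i)}\cup\dots\cup H^{(t)}_{\pi_t(i)}$. Then: (1) $F_\Pi(\Gamma^{(1)},\dots,\Gamma^{(t)})$ has a spread (a partition of its vertex set into cliques) consisting of $1$-regular cliques, each of size $\lambda+2$; (2) $F_\Pi(\Gamma^{(1)},\dots,\Gamma^{(t)})$ is an edge-regular graph with parameters $(vt,\,k+\lambda+1,\,\lambda)$.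
   Context: All graphs are finite, simple and undirected. A graph is edge-regular with parameters $(v,k,\lambda)$ if it has $v$ vertices, is non-empty (has at least one edge), is $k$-regular, and every two adjacent vertices have exactly $\lambda$ common neighbours. A subset $C$ of vertices of a graph is a perfect $1$-code if every vertex not in $C$ is adjacent to exactly one vertex of $C$ and the closed neighbourhoods (balls of radius 1) of the vertices of $C$ partition the vertex set (in particular $C$ is an independent set). A clique $S$ in a regular graph is $m$-regular (has nexus $m$), for an integer $m>0$, if every vertex not in $S$ is adjacent to exactly $m$ vertices of $S$. *)

theory Defs
  imports "Graph_Theory.Pair_Digraph" "HOL-Library.Disjoint_Sets" "HOL-Combinatorics.Permutations"
begin

text \<open>A finite simple undirected graph is a \<open>pair_graph\<close>: a finite vertex set with a symmetric,
  irreflexive set of arcs, every edge being represented by its two orientations. So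
  \<open>(x, y) \<in> parcs G\<close> says that \<open>x\<close> and \<open>y\<close> are adjacent, and the degree of a vertex is its
  \<open>out_degree\<close>.\<close>

definition neighbourhood :: "'a pair_pre_digraph \<Rightarrow> 'a \<Rightarrow> 'a set" where
  "neighbourhood G x = {y \<in> pverts G. (x, y) \<in> parcs G}"

definition closed_neighbourhood :: "'a pair_pre_digraph \<Rightarrow> 'a \<Rightarrow> 'a set" where
  "closed_neighbourhood G x = insert x (neighbourhood G x)"

definition regular_graph :: "'a pair_pre_digraph \<Rightarrow> nat \<Rightarrow> bool" where
  "regular_graph G k \<longleftrightarrow> pair_graph G \<and> (\<forall>x\<in>pverts G. out_degree (with_proj G) x = k)"

definition edge_regular :: "'a pair_pre_digraph \<Rightarrow> nat \<Rightarrow> nat \<Rightarrow> nat \<Rightarrow> bool" where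
  "edge_regular G v k lam \<longleftrightarrow>
     regular_graph G k \<and> card (pverts G) = v \<and> parcs G \<noteq> {} \<and>
     (\<forall>(x, y)\<in>parcs G. card (neighbourhood G x \<inter> neighbourhood G y) = lam)"

text \<open>The closed neighbourhoods are required to be disjoint as a family indexed by \<open>C\<close>, not merely
  as a set of sets: two adjacent vertices with equal closed neighbourhoods cannot both be in \<open>C\<close>.\<close>

definition perfect_1_code :: "'a pair_pre_digraph \<Rightarrow> 'a set \<Rightarrow> bool" where
  "perfect_1_code G C \<longleftrightarrow>
     C \<subseteq> pverts G \<and>
     (\<forall>x\<in>pverts G - C. \<exists>!c. c \<in> C \<and> (x, c) \<in> parcs G) \<and>
     disjoint_family_on (closed_neighbourhood G) C \<and>
     (\<Union>c\<in>C. closed_neighbourhood G c) = pverts G"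

definition clique :: "'a pair_pre_digraph \<Rightarrow> 'a set \<Rightarrow> bool" where
  "clique G S \<longleftrightarrow> S \<subseteq> pverts G \<and> (\<forall>x\<in>S. \<forall>y\<in>S. x \<noteq> y \<longrightarrow> (x, y) \<in> parcs G)"

definition regular_clique :: "'a pair_pre_digraph \<Rightarrow> nat \<Rightarrow> 'a set \<Rightarrow> bool" where
  "regular_clique G m S \<longleftrightarrow>
     (\<exists>k. regular_graph G k) \<and> clique G S \<and> 0 < m \<and>
     (\<forall>x\<in>pverts G - S. card (neighbourhood G x \<inter> S) = m)"

definition spread :: "'a pair_pre_digraph \<Rightarrow> 'a set set \<Rightarrow> bool" where
  "spread G \<S> \<longleftrightarrow> partition_on (pverts G) \<S> \<and> (\<forall>S\<in>\<S>. clique G S)"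

text \<open>\<open>H l i\<close> is the \<open>i\<close>-th code of the \<open>l\<close>-th graph; of \<open>\<pi>\<close> only
  \<open>\<pi> 2, \<dots>, \<pi> t\<close> are used.\<close>

definition merged_codes ::
  "nat \<Rightarrow> (nat \<Rightarrow> nat \<Rightarrow> 'a set) \<Rightarrow> (nat \<Rightarrow> nat \<Rightarrow> nat) \<Rightarrow> nat \<Rightarrow> 'a set" where
  "merged_codes t H \<pi> i = H 1 i \<union> (\<Union>l\<in>{2..t}. H l (\<pi> l i))"

text \<open>The graph \<open>F\<^sub>\<Pi>(\<Gamma> 1, \<dots>, \<Gamma> t)\<close>, where each \<open>\<Gamma> l\<close> comes with codes \<open>H l 1, \<dots>, H l n\<close>. The
  union is a disjoint union only if the vertex sets of the \<open>\<Gamma> l\<close> are pairwise disjoint.\<close>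

definition F_graph ::
  "nat \<Rightarrow> nat \<Rightarrow> (nat \<Rightarrow> 'a pair_pre_digraph) \<Rightarrow> (nat \<Rightarrow> nat \<Rightarrow> 'a set) \<Rightarrow>
    (nat \<Rightarrow> nat \<Rightarrow> nat) \<Rightarrow> 'a pair_pre_digraph" where
  "F_graph t n \<Gamma> H \<pi> =
     \<lparr> pverts = (\<Union>l\<in>{1..t}. pverts (\<Gamma> l)),
       parcs = (\<Union>l\<in>{1..t}. parcs (\<Gamma> l)) \<union>
         {(x, y). x \<noteq> y \<and> (\<exists>i\<in>{1..n}. x \<in> merged_codes t H \<pi> i \<and> y \<in> merged_codes t H \<pi> i)} \<rparr>"

end

theory Submission
  imports Defs
begin

text \<open>Reindexing the codes by \<open>\<Pi>\<close>, one may glue the \<open>i\<close>-th codes of all the graphs into a block of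
  \<open>t a = \<lambda> + 2\<close> vertices, so that a vertex \<open>x\<close> of \<open>\<Gamma> l\<close> lying in the \<open>i\<close>-th block gains the
  \<open>\<lambda> + 1\<close> other vertices of that block as neighbours. Two vertices of one block have no common
  neighbour outside it, since the closed neighbourhoods in \<open>\<Gamma> l\<close> of the vertices of a perfect code
  are disjoint; they thus have exactly \<open>\<lambda>\<close> common neighbours. For an old edge \<open>xy\<close> of \<open>\<Gamma> l\<close>, with
  \<open>x\<close> in block \<open>i\<close> and \<open>y\<close> in block \<open>j\<close>, the only neighbour of \<open>x\<close> in block \<open>j\<close> is \<open>y\<close> itself
  and vice versa, so that no common neighbour is gained. The same uniqueness makes the
  blocks \<open>1\<close>-regular.\<close>

section \<open>Neighbourhoods and perfect codes in a single graph\<close>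

lemma pair_graph_iff:
  "pair_graph G \<longleftrightarrow>
     finite (pverts G) \<and> parcs G \<subseteq> pverts G \<times> pverts G \<and> sym (parcs G) \<and> irrefl (parcs G)"
proof
  assume "pair_graph G"
  then interpret pair_graph G .
  show "finite (pverts G) \<and> parcs G \<subseteq> pverts G \<times> pverts G \<and> sym (parcs G) \<and> irrefl (parcs G)"
    using pair_finite_verts in_arcsD1 in_arcsD2 pair_sym_arcs
    by (auto simp: symmetric_def irrefl_def dest: pair_no_loops)
next
  assume *: "finite (pverts G) \<and> parcs G \<subseteq> pverts G \<times> pverts G \<and> sym (parcs G) \<and> irrefl (parcs G)"
  then have "finite (parcs G)"
    by (meson finite_SigmaI finite_subset)
  with * show "pair_graph G"
    by unfold_locales (auto simp: symmetric_def irrefl_def)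
qed

lemma out_degree_eq_card_neighbourhood:
  assumes "pair_graph G"
  shows "out_degree (with_proj G) x = card (neighbourhood G x)"
proof -
  have "out_arcs (with_proj G) x = Pair x ` neighbourhood G x"
    using assms by (auto simp: out_arcs_def neighbourhood_def pair_graph_iff)
  then show ?thesis
    by (simp add: out_degree_def card_image inj_on_def)
qed

lemma perfect_1_code_neighbourhood_Int:
  assumes "perfect_1_code G C" "x \<in> pverts G" "x \<notin> C"
  shows "\<exists>c. neighbourhood G x \<inter> C = {c}"
proof -
  have "\<exists>!c. c \<in> C \<and> (x, c) \<in> parcs G" and "C \<subseteq> pverts G"
    using assms by (auto simp: perfect_1_code_def)
  then show ?thesis
    unfolding neighbourhood_def by blast
qed

text \<open>A neighbour \<open>y\<close> of \<open>x\<close> inside \<open>C\<close> would lie in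
  the closed neighbourhoods of both \<open>x\<close> and \<open>y\<close>, which are
  disjoint.\<close>

lemma perfect_1_code_independent:
  assumes "perfect_1_code G C" "pair_graph G" "x \<in> C"
  shows "neighbourhood G x \<inter> C = {}"
proof (rule ccontr)
  assume "neighbourhood G x \<inter> C \<noteq> {}"
  then obtain y where y: "y \<in> neighbourhood G x" "y \<in> C" by blast
  then have "x \<noteq> y"
    using assms(2) by (auto simp: neighbourhood_def pair_graph_iff irrefl_def)
  then have "closed_neighbourhood G x \<inter> closed_neighbourhood G y = {}"
    using assms(1,3) y(2) by (simp add: perfect_1_code_def disjoint_family_on_def)
  with y(1) show False
    by (simp add: closed_neighbourhood_def)
qed

lemma perfect_1_code_no_common_neighbours:
  assumes "perfect_1_code G C" "x \<in> C" "y \<in> C" "x \<noteq> y"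
  shows "neighbourhood G x \<inter> neighbourhood G y = {}"
proof -
  have "closed_neighbourhood G x \<inter> closed_neighbourhood G y = {}"
    using assms by (simp add: perfect_1_code_def disjoint_family_on_def)
  then show ?thesis
    by (auto simp: closed_neighbourhood_def)
qed

text \<open>\<open>K l i\<close> is the code that the graph \<open>\<Gamma> l\<close> contributes to
  block \<open>i\<close>. The permutations are meant to be absorbed into \<open>K\<close>, so no
  graph is singled out and the index sets can be arbitrary types of labels.\<close>

locale code_partitioned_graphs =
  fixes L :: "'l set" and I :: "'i set"
    and \<Gamma> :: "'l \<Rightarrow> 'a pair_pre_digraph" and K :: "'l \<Rightarrow> 'i \<Rightarrow> 'a set"
    and v k lam a :: nat
  assumes finite_L: "finite L"
    and a_pos: "0 < a"
    and card_L: "card L * a = lam + 2"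
    and edge_regular: "l \<in> L \<Longrightarrow> edge_regular (\<Gamma> l) v k lam"
    and disjoint_verts: "disjoint_family_on (\<lambda>l. pverts (\<Gamma> l)) L"
    and code: "l \<in> L \<Longrightarrow> i \<in> I \<Longrightarrow> perfect_1_code (\<Gamma> l) (K l i)"
    and card_code: "l \<in> L \<Longrightarrow> i \<in> I \<Longrightarrow> card (K l i) = a"
    and disjoint_codes: "l \<in> L \<Longrightarrow> disjoint_family_on (K l) I"
    and Un_codes: "l \<in> L \<Longrightarrow> (\<Union>i\<in>I. K l i) = pverts (\<Gamma> l)"
begin

section \<open>Codes and blocks\<close>

definition block :: "'i \<Rightarrow> 'a set" where
  "block i = (\<Union>l\<in>L. K l i)"

definition glued :: "'a pair_pre_digraph" where
  "glued =
     \<lparr> pverts = (\<Union>l\<in>L. pverts (\<Gamma> l)),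
       parcs = (\<Union>l\<in>L. parcs (\<Gamma> l)) \<union>
         {(x, y). x \<noteq> y \<and> (\<exists>i\<in>I. x \<in> block i \<and> y \<in> block i)} \<rparr>"

lemma L_nonempty: "L \<noteq> {}"
  using card_L by auto

lemma pair_graph: "l \<in> L \<Longrightarrow> pair_graph (\<Gamma> l)"
  using edge_regular by (simp add: edge_regular_def regular_graph_def)

lemma arcD:
  assumes "l \<in> L" "(x, y) \<in> parcs (\<Gamma> l)"
  shows "x \<in> pverts (\<Gamma> l)" "y \<in> pverts (\<Gamma> l)" "(y, x) \<in> parcs (\<Gamma> l)" "x \<noteq> y"
  using pair_graph[OF assms(1)] assms(2)
  by (auto simp: pair_graph_iff irrefl_def sym_def)

lemma code_subset: "l \<in> L \<Longrightarrow> i \<in> I \<Longrightarrow> K l i \<subseteq> pverts (\<Gamma> l)"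
  using Un_codes by blast

lemma verts_unique:
  "l \<in> L \<Longrightarrow> m \<in> L \<Longrightarrow> x \<in> pverts (\<Gamma> l) \<Longrightarrow> x \<in> pverts (\<Gamma> m) \<Longrightarrow> l = m"
  using disjoint_verts by (auto simp: disjoint_family_on_def)

lemma code_unique:
  assumes "l \<in> L" "m \<in> L" "i \<in> I" "j \<in> I" "x \<in> K l i" "x \<in> K m j"
  shows "l = m" "i = j"
proof -
  show "l = m"
    using assms code_subset verts_unique by blast
  then show "i = j"
    using assms disjoint_codes[of l] by (auto simp: disjoint_family_on_def)
qed

lemma codeE:
  assumes "x \<in> pverts (\<Gamma> l)" "l \<in> L"
  obtains i where "i \<in> I" "x \<in> K l i"
  using assms Un_codes by blast

text \<open>The other codes in the block lie in graphs whose vertex sets are disjoint from that of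
  \<open>\<Gamma> l\<close>. Questions about old neighbours inside a block thus reduce to a single
  code.\<close>

lemma block_Int_verts: "l \<in> L \<Longrightarrow> i \<in> I \<Longrightarrow> block i \<inter> pverts (\<Gamma> l) = K l i"
  unfolding block_def using code_subset verts_unique by blast

lemma block_disjoint: "i \<in> I \<Longrightarrow> j \<in> I \<Longrightarrow> i \<noteq> j \<Longrightarrow> block i \<inter> block j = {}"
  unfolding block_def using code_unique(2) by blast

text \<open>Infinite sets have cardinality 0, so the positive size \<open>a\<close> forces
  finiteness.\<close>

lemma finite_code: "l \<in> L \<Longrightarrow> i \<in> I \<Longrightarrow> finite (K l i)"
  using card_code a_pos card_ge_0_finite by metis

lemma finite_block: "i \<in> I \<Longrightarrow> finite (block i)"
  unfolding block_def using finite_L finite_code by blast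

lemma card_block:
  assumes "i \<in> I"
  shows "card (block i) = lam + 2"
proof -
  have "card (block i) = (\<Sum>l\<in>L. card (K l i))"
    unfolding block_def using finite_L finite_code assms code_unique(1)
    by (intro card_UN_disjoint) blast+
  also have "\<dots> = lam + 2"
    using card_code assms card_L by simp
  finally show ?thesis .
qed

section \<open>The glued graph and its neighbourhoods\<close>

lemma pverts_glued: "pverts glued = (\<Union>l\<in>L. pverts (\<Gamma> l))"
  by (simp add: glued_def)

lemma parcs_glued:
  "(x, y) \<in> parcs glued \<longleftrightarrow>
     (\<exists>l\<in>L. (x, y) \<in> parcs (\<Gamma> l)) \<or> x \<noteq> y \<and> (\<exists>i\<in>I. x \<in> block i \<and> y \<in> block i)"
  by (auto simp: glued_def)

lemma block_subset: "i \<in> I \<Longrightarrow> block i \<subseteq> pverts glued"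
  unfolding block_def pverts_glued using code_subset by blast

lemma glued_vertexE:
  assumes "x \<in> pverts glued"
  obtains l i where "l \<in> L" "i \<in> I" "x \<in> K l i"
  using assms codeE unfolding pverts_glued by blast

lemma pair_graph_glued: "pair_graph glued"
proof -
  have "finite (pverts glued)"
    unfolding pverts_glued using finite_L pair_graph by (auto simp: pair_graph_iff)
  moreover have "parcs glued \<subseteq> pverts glued \<times> pverts glued"
    using arcD(1,2) block_subset by (fastforce simp: parcs_glued pverts_glued)
  moreover have "sym (parcs glued)"
    using arcD(3) unfolding sym_def parcs_glued by blast
  moreover have "irrefl (parcs glued)"
    using arcD(4) by (auto simp: parcs_glued irrefl_def)
  ultimately show ?thesis
    by (simp add: pair_graph_iff)
qed

lemma neighbourhood_subset: "neighbourhood (\<Gamma> l) x \<subseteq> pverts (\<Gamma> l)"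
  by (auto simp: neighbourhood_def)

lemma neighbourhood_Int_block:
  "l \<in> L \<Longrightarrow> i \<in> I \<Longrightarrow> neighbourhood (\<Gamma> l) x \<inter> block i = neighbourhood (\<Gamma> l) x \<inter> K l i"
  using block_Int_verts neighbourhood_subset by blast

text \<open>A vertex lies in exactly one graph and exactly one block, so its new arcs all stay in
  that block. All later counts start from this decomposition.\<close>

lemma neighbourhood_glued:
  assumes "l \<in> L" "i \<in> I" "x \<in> K l i"
  shows "neighbourhood glued x = neighbourhood (\<Gamma> l) x \<union> (block i - {x})"
proof (intro equalityI subsetI)
  fix y assume "y \<in> neighbourhood glued x"
  then consider m where "m \<in> L" "(x, y) \<in> parcs (\<Gamma> m)"
    | j where "x \<noteq> y" "j \<in> I" "x \<in> block j" "y \<in> block j"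
    by (auto simp: neighbourhood_def parcs_glued)
  then show "y \<in> neighbourhood (\<Gamma> l) x \<union> (block i - {x})"
  proof cases
    case 1
    then have "m = l"
      using assms arcD(1) code_subset verts_unique by blast
    with 1 show ?thesis
      using arcD(2) by (auto simp: neighbourhood_def)
  next
    case 2
    then have "j = i"
      using assms code_unique(2) by (auto simp: block_def)
    with 2 show ?thesis by simp
  qed
next
  fix y assume "y \<in> neighbourhood (\<Gamma> l) x \<union> (block i - {x})"
  moreover have "x \<in> block i"
    using assms by (auto simp: block_def)
  ultimately show "y \<in> neighbourhood glued x"
    using assms(1,2) block_subset
    by (auto simp: neighbourhood_def parcs_glued) (auto simp: pverts_glued)
qed

text \<open>Within \<open>\<Gamma> l\<close> the block is just the code \<open>K l i\<close>, which
  is independent. This makes the decomposition of \<open>neighbourhood glued x\<close> a disjoint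
  union.\<close>

lemma neighbourhood_Int_own_block:
  assumes "l \<in> L" "i \<in> I" "x \<in> K l i"
  shows "neighbourhood (\<Gamma> l) x \<inter> block i = {}"
  using assms perfect_1_code_independent code pair_graph neighbourhood_Int_block by metis

section \<open>Degrees and common neighbours\<close>

lemma regular_graph_glued: "regular_graph glued (k + lam + 1)"
  unfolding regular_graph_def
proof (intro conjI ballI pair_graph_glued)
  fix x assume "x \<in> pverts glued"
  then obtain l i where li: "l \<in> L" "i \<in> I" "x \<in> K l i"
    by (rule glued_vertexE)
  then have x: "x \<in> pverts (\<Gamma> l)" "x \<in> block i"
    using code_subset by (auto simp: block_def)
  have fin: "finite (neighbourhood (\<Gamma> l) x)"
    using pair_graph[OF li(1)] by (simp add: neighbourhood_def pair_graph_iff)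
  have "card (neighbourhood (\<Gamma> l) x) = k"
    using edge_regular[OF li(1)] x(1) out_degree_eq_card_neighbourhood[OF pair_graph[OF li(1)]]
    by (auto simp: edge_regular_def regular_graph_def)
  moreover have "card (block i - {x}) = lam + 1"
    using card_block x(2) li(2) by simp
  moreover have "neighbourhood (\<Gamma> l) x \<inter> (block i - {x}) = {}"
    using neighbourhood_Int_own_block[OF li] by blast
  ultimately have "card (neighbourhood glued x) = k + lam + 1"
    using fin finite_block li(2) by (simp add: neighbourhood_glued[OF li] card_Un_disjoint)
  then show "out_degree (with_proj glued) x = k + lam + 1"
    by (simp add: out_degree_eq_card_neighbourhood pair_graph_glued)
qed

lemma card_common_neighbours_block:
  assumes "i \<in> I" "x \<in> block i" "y \<in> block i" "x \<noteq> y"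
  shows "card (neighbourhood glued x \<inter> neighbourhood glued y) = lam"
proof -
  obtain l m where l: "l \<in> L" "x \<in> K l i" and m: "m \<in> L" "y \<in> K m i"
    using assms by (auto simp: block_def)
  \<comment> \<open>In one graph, \<open>x\<close> and \<open>y\<close> belong to the same perfect
    code; in different graphs, their old neighbours lie in disjoint vertex sets.\<close>
  have "neighbourhood (\<Gamma> l) x \<inter> neighbourhood (\<Gamma> m) y = {}"
  proof (cases "l = m")
    case True
    then show ?thesis
      using perfect_1_code_no_common_neighbours[OF code] l m assms by blast
  next
    case False
    then show ?thesis
      using verts_unique neighbourhood_subset l m by blast
  qed
  \<comment> \<open>The mixed terms vanish as well: old neighbours of \<open>x\<close> or
    \<open>y\<close> avoid block \<open>i\<close>.\<close>
  then have "neighbourhood glued x \<inter> neighbourhood glued y = block i - {x, y}"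
    using neighbourhood_Int_own_block[OF l(1) assms(1) l(2)]
      neighbourhood_Int_own_block[OF m(1) assms(1) m(2)]
    unfolding neighbourhood_glued[OF l(1) assms(1) l(2)] neighbourhood_glued[OF m(1) assms(1) m(2)]
    by blast
  then show ?thesis
    using assms card_block finite_block by (simp add: card_Diff_subset)
qed

lemma card_common_neighbours_arc:
  assumes "l \<in> L" "(x, y) \<in> parcs (\<Gamma> l)"
  shows "card (neighbourhood glued x \<inter> neighbourhood glued y) = lam"
proof -
  have xy: "x \<in> neighbourhood (\<Gamma> l) y" "y \<in> neighbourhood (\<Gamma> l) x"
    using arcD[OF assms] assms(2) by (auto simp: neighbourhood_def)
  obtain i j where i: "i \<in> I" "x \<in> K l i" and j: "j \<in> I" "y \<in> K l j"
    using arcD(1,2)[OF assms] assms(1) codeE by metis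
  have "neighbourhood (\<Gamma> l) x \<inter> K l i = {}"
    using perfect_1_code_independent code pair_graph assms(1) i by metis
  then have "i \<noteq> j"
    using xy(2) j(2) by blast
  then have x: "x \<notin> K l j" and y: "y \<notin> K l i"
    using code_unique(2) i j assms(1) by blast+
  have "neighbourhood (\<Gamma> l) x \<inter> K l j = {y}"
    using perfect_1_code_neighbourhood_Int[OF code[OF assms(1) j(1)] arcD(1)[OF assms] x] xy(2) j(2)
    by (metis IntI singletonD)
  moreover have "neighbourhood (\<Gamma> l) y \<inter> K l i = {x}"
    using perfect_1_code_neighbourhood_Int[OF code[OF assms(1) i(1)] arcD(2)[OF assms] y] xy(1) i(2)
    by (metis IntI singletonD)
  \<comment> \<open>An old neighbour of \<open>x\<close> that is a new neighbour of \<open>y\<close>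
    would lie in block \<open>j\<close> and differ from \<open>y\<close>, but \<open>y\<close> is
    the only candidate; the other mixed term is symmetric. A new neighbour of both would lie in two
    disjoint blocks.\<close>
  ultimately have "neighbourhood glued x \<inter> neighbourhood glued y =
      neighbourhood (\<Gamma> l) x \<inter> neighbourhood (\<Gamma> l) y"
    unfolding neighbourhood_glued[OF assms(1) i] neighbourhood_glued[OF assms(1) j]
    using block_disjoint[OF i(1) j(1) \<open>i \<noteq> j\<close>] neighbourhood_Int_block[OF assms(1) i(1), of y]
      neighbourhood_Int_block[OF assms(1) j(1), of x]
    by blast
  then show ?thesis
    using edge_regular[OF assms(1)] assms(2) by (auto simp: edge_regular_def)
qed

lemma edge_regular_glued: "edge_regular glued (v * card L) (k + lam + 1) lam"
proof -
  have "card (pverts glued) = (\<Sum>l\<in>L. card (pverts (\<Gamma> l)))"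
    unfolding pverts_glued using finite_L pair_graph verts_unique
    by (intro card_UN_disjoint) (auto simp: pair_graph_iff)
  also have "\<dots> = v * card L"
    using edge_regular by (simp add: edge_regular_def)
  finally have "card (pverts glued) = v * card L" .
  moreover obtain l where "l \<in> L"
    using L_nonempty by blast
  then have "parcs glued \<noteq> {}"
    using edge_regular by (fastforce simp: edge_regular_def glued_def)
  ultimately show ?thesis
    unfolding edge_regular_def using regular_graph_glued card_common_neighbours_arc
      card_common_neighbours_block by (auto simp: parcs_glued)
qed

section \<open>The spread of 1-regular cliques\<close>

lemma clique_block: "i \<in> I \<Longrightarrow> clique glued (block i)"
  unfolding clique_def using block_subset by (auto simp: parcs_glued)

lemma spread_blocks: "spread glued (block ` I)"
proof -
  have "\<Union> (block ` I) = pverts glued"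
    using block_subset by (force simp: block_def elim: glued_vertexE)
  moreover have "disjoint (block ` I)"
    using block_disjoint by (auto simp: disjoint_def)
  \<comment> \<open>Every block has \<open>lam + 2 > 0\<close> elements.\<close>
  moreover have "{} \<notin> block ` I"
    using card_block by force
  ultimately show ?thesis
    unfolding spread_def partition_on_def using clique_block by blast
qed

text \<open>The new neighbours of an outside vertex lie in its own block, disjoint from block
  \<open>i\<close>; of the old ones, exactly one lies in the code \<open>K l i\<close>.\<close>

lemma regular_clique_block:
  assumes "i \<in> I"
  shows "regular_clique glued 1 (block i)"
proof -
  have "card (neighbourhood glued x \<inter> block i) = 1" if x: "x \<in> pverts glued - block i" for x
  proof -
    obtain l j where lj: "l \<in> L" "j \<in> I" "x \<in> K l j"
      using x by (blast elim: glued_vertexE)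
    then have "i \<noteq> j"
      using x by (auto simp: block_def)
    then have "neighbourhood glued x \<inter> block i = neighbourhood (\<Gamma> l) x \<inter> K l i"
      using neighbourhood_glued[OF lj] block_disjoint[of i j] lj assms
        neighbourhood_Int_block[of l i x] by blast
    moreover have "x \<in> pverts (\<Gamma> l)" "x \<notin> K l i"
      using lj x code_subset by (auto simp: block_def)
    then obtain c where "neighbourhood (\<Gamma> l) x \<inter> K l i = {c}"
      using perfect_1_code_neighbourhood_Int code lj(1) assms by metis
    ultimately show ?thesis by simp
  qed
  then show ?thesis
    unfolding regular_clique_def using regular_graph_glued clique_block assms by auto
qed

end

section \<open>Reindexing by the permutations\<close>

theorem theorem3p1:
  fixes v k lam a t :: nat
    and \<Gamma> :: "nat \<Rightarrow> 'a pair_pre_digraph"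
    and H :: "nat \<Rightarrow> nat \<Rightarrow> 'a set"
    and \<pi> :: "nat \<Rightarrow> nat \<Rightarrow> nat"
  assumes "0 < a" and "a dvd lam + 2" and "t = (lam + 2) div a"
    and "\<And>l. l \<in> {1..t} \<Longrightarrow> edge_regular (\<Gamma> l) v k lam"
    and "disjoint_family_on (\<lambda>l. pverts (\<Gamma> l)) {1..t}"
    and "\<And>l i. l \<in> {1..t} \<Longrightarrow> i \<in> {1..v div a} \<Longrightarrow> perfect_1_code (\<Gamma> l) (H l i) \<and> card (H l i) = a"
    and "\<And>l. l \<in> {1..t} \<Longrightarrow> disjoint_family_on (H l) {1..v div a}"
    and "\<And>l. l \<in> {1..t} \<Longrightarrow> (\<Union>i\<in>{1..v div a}. H l i) = pverts (\<Gamma> l)"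
    and "\<And>l. l \<in> {2..t} \<Longrightarrow> \<pi> l permutes {1..v div a}"
  shows "(\<exists>\<S>. spread (F_graph t (v div a) \<Gamma> H \<pi>) \<S> \<and>
            (\<forall>S\<in>\<S>. regular_clique (F_graph t (v div a) \<Gamma> H \<pi>) 1 S \<and> card S = lam + 2)) \<and>
         edge_regular (F_graph t (v div a) \<Gamma> H \<pi>) (v * t) (k + lam + 1) lam"
proof -
  \<comment> \<open>The first graph keeps its numbering: \<open>\<pi> 1\<close> is arbitrary and
    need not be a permutation, so it is replaced by \<open>id\<close>.\<close>
  define K where "K l = H l \<circ> (if l = 1 then id else \<pi> l)" for l
  let ?I = "{1..v div a}"
  have perm: "(if l = 1 then id else \<pi> l) permutes ?I" if "l \<in> {1..t}" for l
    using that assms(9)[of l] by (auto simp: permutes_id)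
  have t: "t * a = lam + 2"
    using assms(2,3) by simp
  then have "1 \<le> t"
    by (cases t) auto
  interpret code_partitioned_graphs "{1..t}" ?I \<Gamma> K v k lam a
  proof
    fix l assume l: "l \<in> {1..t}"
    note \<sigma> = perm[OF l]
    show "perfect_1_code (\<Gamma> l) (K l i)" "card (K l i) = a" if "i \<in> ?I" for i
      using assms(6)[OF l] permutes_in_image[OF \<sigma>] that by (simp_all only: K_def o_apply)
    show "disjoint_family_on (K l) ?I"
      unfolding disjoint_family_on_def
    proof (intro ballI impI)
      fix i j assume "i \<in> ?I" "j \<in> ?I" "i \<noteq> j"
      \<comment> \<open>Injectivity of the permutation keeps the indices distinct, so disjointness
        of the original codes carries over.\<close>
      then show "K l i \<inter> K l j = {}"
        unfolding K_def o_apply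
        by (intro disjoint_family_onD[OF assms(7)[OF l]])
          (simp_all only: permutes_in_image[OF \<sigma>] inj_eq[OF permutes_inj[OF \<sigma>]]
            not_False_eq_True)
    qed
    show "(\<Union>i\<in>?I. K l i) = pverts (\<Gamma> l)"
      unfolding K_def image_comp[symmetric] permutes_image[OF \<sigma>] by (rule assms(8)[OF l])
  qed (use assms t in auto)
  \<comment> \<open>Splitting off the index 1 matches the shape of \<open>merged_codes\<close>; it
    is valid because \<open>t = 0\<close> would contradict \<open>t * a = lam + 2\<close>.\<close>
  have L: "{1..t} = insert 1 {2..t}"
    using \<open>1 \<le> t\<close> by auto
  have "merged_codes t H \<pi> = block"
    unfolding fun_eq_iff merged_codes_def block_def unfolding L by (auto simp: K_def)
  then have "F_graph t (v div a) \<Gamma> H \<pi> = glued"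
    by (simp only: F_graph_def glued_def)
  moreover have "\<forall>S\<in>block ` ?I. regular_clique glued 1 S \<and> card S = lam + 2"
    using regular_clique_block card_block by blast
  ultimately show ?thesis
    using spread_blocks edge_regular_glued by auto
qed

end
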